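(* Let $\Bbbk$ be a field, let $q\in\Bbbk$ be non-zero, and let $A=\Bbbk\langle X,Y\rangle/(X^2,\,YX-qXY,\,Y^2)$, with $x,y$ the classes of $X,Y$, be viewed as a Frobenius algebra with respect to the bilinear form $\langle a,b\rangle=\lambda(ab)$, with Nakayama automorphism $\sigma$. Let $a,b,c,d\in\Bbbk$ be scalars such that $a\ne0$ and $b\ne0$. The Nakayama Jacobian of the algebra automorphism $\alpha(a,b,c,d):A\to A$ is $$\mathrm{jac}_\sigma(\alpha(a,b,c,d))=ab+dx+q^{-1}cy.$$
   Context: The algebra $A$ has basis $\{1,x,y,xy\}$, and $\lambda:A\to\Bbbk$ is the linear map with $\lambda(1)=\lambda(x)=\lambda(y)=0$ and $\lambda(xy)=1$; the form $\langle a,b\rangle=\lambda(ab)$ is non-degenerate and associative ($\langle ab,c\rangle=\langle a,bc\rangle$). Its Nakayama automorphism $\sigma$ is the unique algebra automorphism with $\langle a,b\rangle=\langle b,\sigma(a)\rangle$ for all $a,b\in A$; explicitly $\sigma(x)=q^{-1}x$ and $\sigma(y)=qy$. $\alpha(a,b,c,d)$ is the algebra automorphism of $A$ with $\alpha(a,b,c,d)(x)=ax+cxy$ and $\alpha(a,b,c,d)(y)=by+dxy$. The Nakayama Jacobian $\mathrm{jac}_\sigma(u)$ of an algebra automorphism $u$ is the unique element of $A$ such that $\langle u(r),u(s)\rangle=\langle\mathrm{jac}_\sigma(u)\cdot r,s\rangle$ for all $r,s\in A$. *)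

theory Defs
  imports "HOL-Algebra.QuotRing" "HOL-Algebra.Module" "HOL-Library.Poly_Mapping"
begin

text \<open>The free monoid on a set of letters, written additively so that finitely supported functions
  on it form its monoid algebra, with the convolution product of \<^theory>\<open>HOL-Library.Poly_Mapping\<close>.\<close>

datatype 'v free_monoid = Word (letters: "'v list")

instantiation free_monoid :: (type) monoid_add
begin

definition zero_free_monoid :: "'a free_monoid"
  where "0 = Word []"

definition plus_free_monoid :: "'a free_monoid \<Rightarrow> 'a free_monoid \<Rightarrow> 'a free_monoid"
  where "v + w = Word (letters v @ letters w)"

instance
  by standard (simp_all add: zero_free_monoid_def plus_free_monoid_def)

end

type_synonym ('v, 'k) free_algebra = "'v free_monoid \<Rightarrow>\<^sub>0 'k"

definition free_const :: "'k::field \<Rightarrow> ('v, 'k) free_algebra"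
  where "free_const c = Poly_Mapping.single 0 c"

definition free_var :: "'v \<Rightarrow> ('v, 'k::field) free_algebra"
  where "free_var v = Poly_Mapping.single (Word [v]) 1"

definition free_ring :: "('v, 'k::field) free_algebra ring"
  where "free_ring = \<lparr>carrier = UNIV, mult = (*), one = 1, zero = 0, add = (+)\<rparr>"


text \<open>Algebras over a field \<open>'k\<close> are records of type \<open>('k, 'a) module\<close>. Maps out of
  an algebra are only relevant on its carrier; those picked by a definite description
  are required to be \<^const>\<open>extensional\<close>, so that they are determined by their values there.\<close>

definition linear_functional :: "('k::field, 'a, 'm) module_scheme \<Rightarrow> ('a \<Rightarrow> 'k) \<Rightarrow> bool"
  where "linear_functional A l \<longleftrightarrow>
    (\<forall>u\<in>carrier A. \<forall>v\<in>carrier A. l (u \<oplus>\<^bsub>A\<^esub> v) = l u + l v) \<and>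
    (\<forall>c. \<forall>v\<in>carrier A. l (c \<odot>\<^bsub>A\<^esub> v) = c * l v)"

definition algebra_automorphism :: "('k::field, 'a, 'm) module_scheme \<Rightarrow> ('a \<Rightarrow> 'a) \<Rightarrow> bool"
  where "algebra_automorphism A u \<longleftrightarrow>
    u \<in> ring_hom A A \<and>
    (\<forall>c. \<forall>v\<in>carrier A. u (c \<odot>\<^bsub>A\<^esub> v) = c \<odot>\<^bsub>A\<^esub> u v) \<and>
    bij_betw u (carrier A) (carrier A)"

record ('k, 'a) frobenius = "('k, 'a) module" +
  form :: "'a \<Rightarrow> 'a \<Rightarrow> 'k"
  nakayama :: "'a \<Rightarrow> 'a"

definition nakayama_automorphism ::
    "('k::field, 'a, 'm) module_scheme \<Rightarrow> ('a \<Rightarrow> 'a \<Rightarrow> 'k) \<Rightarrow> 'a \<Rightarrow> 'a"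
  where "nakayama_automorphism A B = (THE s.
    s \<in> extensional (carrier A) \<and> algebra_automorphism A s \<and>
    (\<forall>u\<in>carrier A. \<forall>v\<in>carrier A. B u v = B v (s u)))"

definition frobenius_of ::
    "('k::field, 'a) module \<Rightarrow> ('a \<Rightarrow> 'a \<Rightarrow> 'k) \<Rightarrow> ('k, 'a) frobenius"
  where "frobenius_of A B =
    module.extend A (frobenius.fields B (nakayama_automorphism A B))"

text \<open>The Jacobian is determined by the form alone; the automorphism \<open>\<sigma>\<close> in the notation
  \<open>jac\<^sub>\<sigma>\<close> is itself determined by the form.\<close>

definition nakayama_jacobian :: "('k::field, 'a) frobenius \<Rightarrow> ('a \<Rightarrow> 'a) \<Rightarrow> 'a"
  where "nakayama_jacobian F u = (THE j.
    j \<in> carrier F \<and>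
    (\<forall>r\<in>carrier F. \<forall>s\<in>carrier F. form F (u r) (u s) = form F (j \<otimes>\<^bsub>F\<^esub> r) s))"


datatype gen = GenX | GenY

definition q_relations :: "'k::field \<Rightarrow> (gen, 'k) free_algebra set"
  where "q_relations q =
    {free_var GenX * free_var GenX,
     free_var GenY * free_var GenX - free_const q * (free_var GenX * free_var GenY),
     free_var GenY * free_var GenY}"

definition q_ideal :: "'k::field \<Rightarrow> (gen, 'k) free_algebra set"
  where "q_ideal q = Idl\<^bsub>free_ring\<^esub> (q_relations q)"

definition q_class :: "'k::field \<Rightarrow> (gen, 'k) free_algebra \<Rightarrow> (gen, 'k) free_algebra set"
  where "q_class q p = q_ideal q +>\<^bsub>free_ring\<^esub> p"

text \<open>The quotient ring, with scalars acting through the structure map from \<open>'k\<close> to the quotient.\<close>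

definition q_algebra :: "'k::field \<Rightarrow> ('k, (gen, 'k) free_algebra set) module"
  where "q_algebra q =
    ring.extend (free_ring Quot q_ideal q)
      (module.fields (\<lambda>c v. q_class q (free_const c) \<otimes>\<^bsub>free_ring Quot q_ideal q\<^esub> v))"

definition q_x :: "'k::field \<Rightarrow> (gen, 'k) free_algebra set"
  where "q_x q = q_class q (free_var GenX)"

definition q_y :: "'k::field \<Rightarrow> (gen, 'k) free_algebra set"
  where "q_y q = q_class q (free_var GenY)"

definition q_lambda :: "'k::field \<Rightarrow> (gen, 'k) free_algebra set \<Rightarrow> 'k"
  where "q_lambda q = (THE l.
    l \<in> extensional (carrier (q_algebra q)) \<and> linear_functional (q_algebra q) l \<and>
    l \<one>\<^bsub>q_algebra q\<^esub> = 0 \<and> l (q_x q) = 0 \<and> l (q_y q) = 0 \<and>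
    l (q_x q \<otimes>\<^bsub>q_algebra q\<^esub> q_y q) = 1)"

definition q_frobenius :: "'k::field \<Rightarrow> ('k, (gen, 'k) free_algebra set) frobenius"
  where "q_frobenius q =
    frobenius_of (q_algebra q) (\<lambda>u v. q_lambda q (u \<otimes>\<^bsub>q_algebra q\<^esub> v))"

definition q_alpha :: "'k::field \<Rightarrow> 'k \<Rightarrow> 'k \<Rightarrow> 'k \<Rightarrow> 'k \<Rightarrow>
    (gen, 'k) free_algebra set \<Rightarrow> (gen, 'k) free_algebra set"
  where "q_alpha q a b c d = (THE u.
    u \<in> extensional (carrier (q_algebra q)) \<and> algebra_automorphism (q_algebra q) u \<and>
    u (q_x q) = a \<odot>\<^bsub>q_algebra q\<^esub> q_x q \<oplus>\<^bsub>q_algebra q\<^esub>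
      c \<odot>\<^bsub>q_algebra q\<^esub> (q_x q \<otimes>\<^bsub>q_algebra q\<^esub> q_y q) \<and>
    u (q_y q) = b \<odot>\<^bsub>q_algebra q\<^esub> q_y q \<oplus>\<^bsub>q_algebra q\<^esub>
      d \<odot>\<^bsub>q_algebra q\<^esub> (q_x q \<otimes>\<^bsub>q_algebra q\<^esub> q_y q))"

end

theory Submission imports Defs begin

text \<open>Four linear functionals on the free algebra (the coefficients of \<open>1\<close>, \<open>X\<close>, \<open>Y\<close>, and the
  coefficient of \<open>XY\<close> plus \<open>q\<close> times that of \<open>YX\<close>) have the defining ideal as common kernel: the
  kernel is an ideal containing the relations, and modulo the relations every element is congruent
  to its normal form \<open>k + lX + mY + nXY\<close>. Hence \<open>{1, x, y, xy}\<close> is a basis of \<open>A\<close>, and \<open>\<lambda>\<close> and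
  \<open>\<alpha>(a,b,c,d)\<close> are given by explicit formulas in coordinates. Testing
  \<open>\<langle>u(r), u(1)\<rangle> = \<langle>j r, 1\<rangle>\<close> on the basis then determines the four coordinates of \<open>j\<close>.\<close>

section \<open>Induction and product coefficients in the free algebra\<close>

text \<open>Updating a function at a key outside its support is the same as adding a monomial, which
  turns the library induction into one that suits additive identities.\<close>

lemma poly_mapping_single_add_induct [case_names zero add]:
  fixes p :: "'a \<Rightarrow>\<^sub>0 'b::comm_monoid_add"
  assumes "P 0" and "\<And>w c p. P p \<Longrightarrow> P (Poly_Mapping.single w c + p)"
  shows "P p"
proof (induction p rule: Poly_Mapping.update_induct)
  case (update f a b)
  have "Poly_Mapping.update a b f = Poly_Mapping.single a b + f"
    using update(1)
    by (intro poly_mapping_eqI) (auto simp: lookup_update lookup_add lookup_single in_keys_iff when_def)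
  with assms(2)[OF update(3)] show ?case by simp
qed (fact assms(1))

text \<open>Every monomial is a constant multiplied from the left by letters, one at a time.
  Statements about a product thus reduce to peeling one letter off the left factor.\<close>

lemma free_algebra_induct [case_names const var add]:
  fixes p :: "('v, 'k::field) free_algebra"
  assumes const: "\<And>c. P (free_const c)"
    and var: "\<And>v p. P p \<Longrightarrow> P (free_var v * p)"
    and add: "\<And>p r. P p \<Longrightarrow> P r \<Longrightarrow> P (p + r)"
  shows "P p"
proof (induction p rule: poly_mapping_single_add_induct)
  case zero
  show ?case using const[of 0] by (simp add: free_const_def)
next
  case (add w c p)
  have "P (Poly_Mapping.single (Word vs) c)" for vs
  proof (induction vs)
    case Nil
    then show ?case using const[of c] by (simp add: free_const_def zero_free_monoid_def)
  next
    case (Cons v vs)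
    have "Poly_Mapping.single (Word (v # vs)) c = free_var v * Poly_Mapping.single (Word vs) c"
      by (simp add: free_var_def mult_single plus_free_monoid_def)
    with var[OF Cons] show ?case by simp
  qed
  then show ?case using assms(3) add by (cases w) auto
qed

lemma lookup_free_const:
  "Poly_Mapping.lookup (free_const c) (Word vs) = (if vs = [] then c else 0)"
  by (simp add: free_const_def lookup_single zero_free_monoid_def when_def)

lemma lookup_free_const_mult:
  "Poly_Mapping.lookup (free_const c * p) w = c * Poly_Mapping.lookup p w"
  by (induction p rule: poly_mapping_single_add_induct)
    (auto simp: free_const_def distrib_left lookup_add mult_single lookup_single when_def)

lemma free_const_commute: "free_const c * p = p * free_const c"
  by (induction p rule: poly_mapping_single_add_induct)
    (auto simp: free_const_def algebra_simps mult_single)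

lemma lookup_free_var_mult_Nil: "Poly_Mapping.lookup (free_var v * p) (Word []) = 0"
  by (induction p rule: poly_mapping_single_add_induct)
    (auto simp: free_var_def distrib_left lookup_add mult_single lookup_single when_def
      plus_free_monoid_def)

lemma lookup_free_var_mult_Cons:
  "Poly_Mapping.lookup (free_var v * p) (Word (u # us)) = (if u = v then Poly_Mapping.lookup p (Word us) else 0)"
proof (induction p rule: poly_mapping_single_add_induct)
  case (add w c p)
  then show ?case
    by (cases w) (auto simp: free_var_def distrib_left lookup_add mult_single lookup_single when_def
      plus_free_monoid_def)
qed simp

lemmas lookup_free_var_mult = lookup_free_var_mult_Nil lookup_free_var_mult_Cons

lemma lookup_free_var:
  "Poly_Mapping.lookup (free_var v) (Word vs) = (if vs = [v] then 1 else 0)"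
  by (auto simp: free_var_def lookup_single when_def)

text \<open>This and the next two lemmas sum over the ways to cut a word into a prefix and a suffix.
  Each length rests on the shorter ones, since peeling a letter off the left factor shortens the
  word. Length two suffices because the relations and normal forms have degree at most two.\<close>

lemma lookup_times_Nil:
  fixes p r :: "('v, 'k::field) free_algebra"
  shows
  "Poly_Mapping.lookup (p * r) (Word []) = Poly_Mapping.lookup p (Word []) * Poly_Mapping.lookup r (Word [])"
  by (induction p rule: free_algebra_induct)
    (auto simp: lookup_free_const lookup_free_const_mult mult.assoc lookup_free_var_mult
      distrib_right lookup_add)

lemma lookup_times_single:
  fixes p r :: "('v, 'k::field) free_algebra"
  shows
  "Poly_Mapping.lookup (p * r) (Word [s]) =
    Poly_Mapping.lookup p (Word []) * Poly_Mapping.lookup r (Word [s]) + Poly_Mapping.lookup p (Word [s]) * Poly_Mapping.lookup r (Word [])"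
  by (induction p rule: free_algebra_induct)
    (auto simp: lookup_free_const lookup_free_const_mult mult.assoc lookup_free_var_mult
      distrib_right lookup_add lookup_times_Nil lookup_free_var)

lemma lookup_times_double:
  fixes p r :: "('v, 'k::field) free_algebra"
  shows
  "Poly_Mapping.lookup (p * r) (Word [s, t]) =
    Poly_Mapping.lookup p (Word []) * Poly_Mapping.lookup r (Word [s, t]) + Poly_Mapping.lookup p (Word [s]) * Poly_Mapping.lookup r (Word [t])
    + Poly_Mapping.lookup p (Word [s, t]) * Poly_Mapping.lookup r (Word [])"
  by (induction p rule: free_algebra_induct)
    (auto simp: lookup_free_const lookup_free_const_mult mult.assoc lookup_free_var_mult
      distrib_right lookup_add lookup_times_Nil lookup_times_single lookup_free_var)

section \<open>Normal forms and the four coefficient functionals\<close>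

definition normal_form :: "'k::field \<Rightarrow> 'k \<Rightarrow> 'k \<Rightarrow> 'k \<Rightarrow> (gen, 'k) free_algebra"
  where "normal_form k l m n = free_const k + free_const l * free_var GenX
    + free_const m * free_var GenY + free_const n * (free_var GenX * free_var GenY)"

abbreviation coeff_1 :: "(gen, 'k::field) free_algebra \<Rightarrow> 'k"
  where "coeff_1 p \<equiv> Poly_Mapping.lookup p (Word [])"

abbreviation coeff_x :: "(gen, 'k::field) free_algebra \<Rightarrow> 'k"
  where "coeff_x p \<equiv> Poly_Mapping.lookup p (Word [GenX])"

abbreviation coeff_y :: "(gen, 'k::field) free_algebra \<Rightarrow> 'k"
  where "coeff_y p \<equiv> Poly_Mapping.lookup p (Word [GenY])"

text \<open>The weight \<open>q\<close> on the word \<open>YX\<close> makes the functional vanish on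
  the relation \<open>YX - qXY\<close>.\<close>

definition coeff_xy :: "'k::field \<Rightarrow> (gen, 'k) free_algebra \<Rightarrow> 'k"
  where "coeff_xy q p = Poly_Mapping.lookup p (Word [GenX, GenY]) + q * Poly_Mapping.lookup p (Word [GenY, GenX])"

lemmas coeff_simps = coeff_xy_def lookup_free_const lookup_free_const_mult lookup_free_var
  lookup_free_var_mult lookup_times_Nil lookup_times_single lookup_times_double lookup_add
  lookup_minus

lemma coeff_normal_form [simp]:
  "coeff_1 (normal_form k l m n) = k" "coeff_x (normal_form k l m n) = l"
  "coeff_y (normal_form k l m n) = m" "coeff_xy q (normal_form k l m n) = n"
  by (simp_all add: normal_form_def coeff_simps)

text \<open>The coefficients of \<open>XX\<close> and \<open>YY\<close> never enter, so the four
  functionals of a product depend only on those of its factors. This is already the multiplication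
  of \<open>A\<close> in coordinates.\<close>

lemma coeff_xy_times:
  "coeff_xy q (p * r) = coeff_1 p * coeff_xy q r + coeff_x p * coeff_y r
    + q * (coeff_y p * coeff_x r) + coeff_xy q p * coeff_1 r"
  by (simp add: coeff_simps algebra_simps)

section \<open>The free algebra as a ring record, and its defining ideal\<close>

lemma ring_free_ring: "ring (free_ring :: ('v, 'k::field) free_algebra ring)"
proof (intro ringI abelian_groupI monoidI)
  fix p :: "('v, 'k) free_algebra"
  show "\<exists>r\<in>carrier free_ring. r \<oplus>\<^bsub>free_ring\<^esub> p = \<zero>\<^bsub>free_ring\<^esub>"
    by (intro bexI[of _ "- p"]) (auto simp: free_ring_def)
qed (auto simp: free_ring_def algebra_simps)

lemma carrier_free_ring [simp]: "carrier free_ring = UNIV"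
  by (simp add: free_ring_def)

lemma free_ring_minus [simp]: "p \<ominus>\<^bsub>free_ring\<^esub> r = p - (r :: ('v, 'k::field) free_algebra)"
proof -
  interpret ring "free_ring :: ('v, 'k) free_algebra ring" by (rule ring_free_ring)
  have "p - r = p \<oplus>\<^bsub>free_ring\<^esub> (- r)" by (simp add: free_ring_def)
  moreover have "\<ominus>\<^bsub>free_ring\<^esub> r = - r"
    by (rule minus_equality) (auto simp: free_ring_def)
  ultimately show ?thesis by (simp add: a_minus_def)
qed

lemma ideal_q_ideal: "ideal (q_ideal q) free_ring"
  unfolding q_ideal_def by (intro ring.genideal_ideal ring_free_ring) auto

lemma q_ideal_add: "p \<in> q_ideal q \<Longrightarrow> r \<in> q_ideal q \<Longrightarrow> p + r \<in> q_ideal q"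
  using additive_subgroup.a_closed[OF ideal.axioms(1)[OF ideal_q_ideal]]
  by (auto simp: free_ring_def)

lemma q_ideal_zero: "0 \<in> q_ideal q"
  using additive_subgroup.zero_closed[OF ideal.axioms(1)[OF ideal_q_ideal]]
  by (auto simp: free_ring_def)

lemma q_ideal_mult_left: "p \<in> q_ideal q \<Longrightarrow> r * p \<in> q_ideal q"
  using ideal.I_l_closed[OF ideal_q_ideal] by (auto simp: free_ring_def)

lemma q_ideal_mult_right: "p \<in> q_ideal q \<Longrightarrow> p * r \<in> q_ideal q"
  using ideal.I_r_closed[OF ideal_q_ideal] by (auto simp: free_ring_def)

lemma q_relations_subset: "q_relations q \<subseteq> q_ideal q"
  unfolding q_ideal_def by (intro ring.genideal_self ring_free_ring) auto

section \<open>Comparison of the common kernel with the defining ideal\<close>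

definition coeff_kernel :: "'k::field \<Rightarrow> (gen, 'k) free_algebra set"
  where "coeff_kernel q = {p. coeff_1 p = 0 \<and> coeff_x p = 0 \<and> coeff_y p = 0 \<and> coeff_xy q p = 0}"

text \<open>In the product rules every summand contains a functional of each factor, so all four
  values vanish as soon as one factor lies in the kernel.\<close>

lemma ideal_coeff_kernel:
  fixes q :: "'k::field"
  shows "ideal (coeff_kernel q) free_ring"
proof -
  interpret ring "free_ring :: (gen, 'k) free_algebra ring" by (rule ring_free_ring)
  have "subgroup (coeff_kernel q) (add_monoid free_ring)"
  proof (rule add.subgroupI)
    fix p assume p: "p \<in> coeff_kernel q"
    \<comment> \<open>The inverse in the record is reached through subtraction from zero, where
      \<open>free_ring_minus\<close> applies.\<close>
    have "\<ominus>\<^bsub>free_ring\<^esub> p = 0 - p"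
      using free_ring_minus[of 0 p] by (simp add: a_minus_def) (simp add: free_ring_def)
    moreover have "coeff_xy q (0 - p) = - coeff_xy q p"
      by (simp add: coeff_xy_def algebra_simps)
    ultimately show "\<ominus>\<^bsub>free_ring\<^esub> p \<in> coeff_kernel q"
      using p by (simp add: coeff_kernel_def)
  next
    have "0 \<in> coeff_kernel q" by (simp add: coeff_kernel_def coeff_xy_def)
    then show "coeff_kernel q \<noteq> {}" by auto
  qed (auto simp: coeff_kernel_def coeff_xy_def free_ring_def lookup_add algebra_simps)
  then show ?thesis
    by (intro idealI ring_free_ring)
      (auto simp: coeff_kernel_def free_ring_def coeff_xy_times lookup_times_Nil lookup_times_single)
qed

text \<open>By minimality of the generated ideal only the three relations need checking. The
  inclusion makes the functionals well defined on \<open>A\<close>, which gives linear independence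
  of 1, x, y, xy.\<close>

lemma q_ideal_subset_coeff_kernel: "q_ideal q \<subseteq> coeff_kernel q"
  unfolding q_ideal_def
  by (intro ring.genideal_minimal ring_free_ring ideal_coeff_kernel)
    (auto simp: q_relations_def coeff_kernel_def coeff_simps)

text \<open>The spanning half: it is enough to reduce a letter times a normal form, using the
  relations once or twice.\<close>

lemma diff_normal_form_mem_q_ideal:
  "p - normal_form (coeff_1 p) (coeff_x p) (coeff_y p) (coeff_xy q p) \<in> q_ideal q"
proof (induction p rule: free_algebra_induct)
  case (const c)
  then show ?case
    by (simp add: coeff_simps normal_form_def q_ideal_zero) (simp add: free_const_def q_ideal_zero)
next
  case (add p r)
  have "(p + r) - normal_form (coeff_1 (p + r)) (coeff_x (p + r)) (coeff_y (p + r)) (coeff_xy q (p + r))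
    = (p - normal_form (coeff_1 p) (coeff_x p) (coeff_y p) (coeff_xy q p))
    + (r - normal_form (coeff_1 r) (coeff_x r) (coeff_y r) (coeff_xy q r))"
    by (simp add: normal_form_def coeff_xy_def lookup_add free_const_def single_add algebra_simps)
  with q_ideal_add[OF add] show ?case by (simp only:)
next
  case (var v p)
  define X Y :: "(gen, 'a) free_algebra" where "X = free_var GenX" and "Y = free_var GenY"
  \<comment> \<open>From here on \<open>k\<close>, \<open>l\<close>, \<open>m\<close>,
    \<open>n\<close> are constant polynomials, central by \<open>comm\<close>, so the reductions
    become identities in a noncommutative ring.\<close>
  define k l m n :: "(gen, 'a) free_algebra" where "k = free_const (coeff_1 p)" and "l = free_const (coeff_x p)"
    and "m = free_const (coeff_y p)" and "n = free_const (coeff_xy q p)"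
  have rel: "X * X \<in> q_ideal q" "Y * X - free_const q * (X * Y) \<in> q_ideal q" "Y * Y \<in> q_ideal q"
    using q_relations_subset[of q] by (auto simp: q_relations_def X_def Y_def)
  have IH: "p - (k + l * X + m * Y + n * (X * Y)) \<in> q_ideal q"
    using var by (simp add: normal_form_def X_def Y_def k_def l_def m_def n_def)
  have comm: "w * k = k * w" "w * l = l * w" "w * m = m * w" "w * n = n * w"
    "w * free_const q = free_const q * w" for w
    by (simp_all add: k_def l_def m_def n_def free_const_commute)
  have c0: "free_const 0 = 0" by (simp add: free_const_def)
  show ?case
  proof (cases v)
    case GenX
    have "normal_form (coeff_1 (X * p)) (coeff_x (X * p)) (coeff_y (X * p)) (coeff_xy q (X * p))
      = k * X + m * (X * Y)"
      by (simp add: normal_form_def coeff_xy_def lookup_free_var_mult c0 X_def Y_def k_def m_def)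
    \<comment> \<open>The first summand is in the ideal by induction; the terms left over all
      contain the factor \<open>X * X\<close>.\<close>
    moreover have "X * p - (k * X + m * (X * Y)) = X * (p - (k + l * X + m * Y + n * (X * Y)))
      + (l * (X * X) + n * (X * X * Y))"
      by (simp add: algebra_simps comm(1-4)[of X, symmetric])
        (simp add: mult.assoc[symmetric] comm)
    ultimately show ?thesis
      using IH rel by (simp add: GenX X_def[symmetric] q_ideal_add q_ideal_mult_left q_ideal_mult_right)
  next
    case GenY
    have "normal_form (coeff_1 (Y * p)) (coeff_x (Y * p)) (coeff_y (Y * p)) (coeff_xy q (Y * p))
      = k * Y + l * (free_const q * (X * Y))"
      by (simp add: normal_form_def coeff_xy_def lookup_free_var_mult c0 X_def Y_def k_def l_def
        free_const_def mult_single mult.assoc[symmetric] mult.commute[of q])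
    \<comment> \<open>The word \<open>YXY\<close> needs two relations: \<open>YX\<close> is
      exchanged for \<open>qXY\<close>, and the resulting \<open>XYY\<close> contains
      \<open>Y * Y\<close>.\<close>
    moreover have "Y * p - (k * Y + l * (free_const q * (X * Y)))
      = Y * (p - (k + l * X + m * Y + n * (X * Y)))
      + (l * (Y * X - free_const q * (X * Y)) + m * (Y * Y)
        + n * ((Y * X - free_const q * (X * Y)) * Y + free_const q * (X * (Y * Y))))"
    proof -
      have "Y * (k + l * X + m * Y + n * (X * Y)) = k * Y + l * (Y * X) + m * (Y * Y) + n * (Y * X * Y)"
        by (simp add: distrib_left mult.assoc[symmetric] comm(1-4)[of Y])
      then show ?thesis by (simp add: right_diff_distrib left_diff_distrib distrib_left mult.assoc)
    qed
    ultimately show ?thesis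
      using IH rel by (simp add: GenY Y_def[symmetric] q_ideal_add q_ideal_mult_left q_ideal_mult_right)
  qed
qed

section \<open>Coordinates and structure constants of the quotient algebra\<close>

lemma q_class_eq_iff_diff: "q_class q p = q_class q r \<longleftrightarrow> p - r \<in> q_ideal q"
  unfolding q_class_def
  using ring.quotient_eq_iff_same_a_r_cos[OF ring_free_ring ideal_q_ideal, of p r q] by simp

text \<open>This is \<open>k + l x + m y + n xy\<close>; all later computations in \<open>A\<close>
  are carried out on these coordinates.\<close>

definition q_elem :: "'k::field \<Rightarrow> 'k \<Rightarrow> 'k \<Rightarrow> 'k \<Rightarrow> 'k \<Rightarrow> (gen, 'k) free_algebra set"
  where "q_elem q k l m n = q_class q (normal_form k l m n)"

lemma q_class_eq_q_elem: "q_class q p = q_elem q (coeff_1 p) (coeff_x p) (coeff_y p) (coeff_xy q p)"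
  by (simp add: q_elem_def q_class_eq_iff_diff diff_normal_form_mem_q_ideal)

text \<open>Linear independence of the basis: a difference of normal forms in the ideal lies in the
  kernel, and the functionals read off its four coefficients.\<close>

lemma q_elem_eq_iff [simp]:
  "q_elem q k l m n = q_elem q k' l' m' n' \<longleftrightarrow> k = k' \<and> l = l' \<and> m = m' \<and> n = n'"
proof
  assume "q_elem q k l m n = q_elem q k' l' m' n'"
  then have "normal_form k l m n - normal_form k' l' m' n' \<in> coeff_kernel q"
    using q_ideal_subset_coeff_kernel by (auto simp: q_elem_def q_class_eq_iff_diff)
  moreover have "coeff_xy q (p - r) = coeff_xy q p - coeff_xy q r" for p r
    by (simp add: coeff_xy_def lookup_minus algebra_simps)
  ultimately show "k = k' \<and> l = l' \<and> m = m' \<and> n = n'"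
    by (simp add: coeff_kernel_def lookup_minus)
qed simp

lemmas q_algebra_defs = q_algebra_def ring.defs module.defs FactRing_def

lemma carrier_q_algebra: "carrier (q_algebra q) = {q_elem q k l m n | k l m n. True}"
proof -
  have "carrier (q_algebra q) = range (q_class q)"
    by (auto simp: q_algebra_defs A_RCOSETS_def' q_class_def)
  also have "\<dots> = {q_elem q k l m n | k l m n. True}"
    using q_class_eq_q_elem by (fastforce simp: q_elem_def)
  finally show ?thesis .
qed

lemma q_elem_carrier [simp]: "q_elem q k l m n \<in> carrier (q_algebra q)"
  by (auto simp: carrier_q_algebra)

lemma q_class_mult: "q_class q p \<otimes>\<^bsub>free_ring Quot q_ideal q\<^esub> q_class q r = q_class q (p * r)"
  using ideal.rcoset_mult_add[OF ideal_q_ideal, of p r q]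
  by (simp add: FactRing_def q_class_def) (simp add: free_ring_def)

text \<open>Multiply normal forms upstairs, then read off coordinates. The term
  \<open>q * (m * l')\<close> stems from \<open>yx = q xy\<close>.\<close>

lemma q_elem_mult [simp]:
  "q_elem q k l m n \<otimes>\<^bsub>q_algebra q\<^esub> q_elem q k' l' m' n' =
    q_elem q (k * k') (k * l' + l * k') (k * m' + m * k') (k * n' + l * m' + q * (m * l') + n * k')"
proof -
  have "q_elem q k l m n \<otimes>\<^bsub>q_algebra q\<^esub> q_elem q k' l' m' n' =
    q_class q (normal_form k l m n * normal_form k' l' m' n')"
    by (simp add: q_class_mult[symmetric] q_elem_def) (simp add: q_algebra_defs)
  then show ?thesis
    by (simp add: q_class_eq_q_elem lookup_times_Nil lookup_times_single coeff_xy_times)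
qed

lemma q_elem_add [simp]:
  "q_elem q k l m n \<oplus>\<^bsub>q_algebra q\<^esub> q_elem q k' l' m' n' = q_elem q (k + k') (l + l') (m + m') (n + n')"
proof -
  have "q_elem q k l m n \<oplus>\<^bsub>q_algebra q\<^esub> q_elem q k' l' m' n' =
    q_class q (normal_form k l m n + normal_form k' l' m' n')"
    using ideal.a_rcos_sum[OF ideal_q_ideal, of "normal_form k l m n" "normal_form k' l' m' n'" q]
    by (simp add: q_algebra_defs q_elem_def q_class_def) (simp add: free_ring_def)
  moreover have "coeff_xy q (p + r) = coeff_xy q p + coeff_xy q r" for p r
    by (simp add: coeff_xy_def lookup_add algebra_simps)
  ultimately show ?thesis by (simp add: q_class_eq_q_elem lookup_add)
qed

lemma q_elem_smult [simp]:
  "c \<odot>\<^bsub>q_algebra q\<^esub> q_elem q k l m n = q_elem q (c * k) (c * l) (c * m) (c * n)"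
proof -
  have "c \<odot>\<^bsub>q_algebra q\<^esub> q_elem q k l m n = q_class q (free_const c * normal_form k l m n)"
    by (simp add: q_class_mult[symmetric] q_elem_def) (simp add: q_algebra_defs)
  moreover have "coeff_xy q (free_const c * p) = c * coeff_xy q p" for p
    by (simp add: coeff_xy_def lookup_free_const_mult algebra_simps)
  ultimately show ?thesis by (simp add: q_class_eq_q_elem lookup_free_const_mult)
qed

lemma q_one_eq: "\<one>\<^bsub>q_algebra q\<^esub> = q_elem q 1 0 0 0"
proof -
  have "\<one>\<^bsub>q_algebra q\<^esub> = q_class q (free_const 1)"
    by (simp add: q_algebra_defs q_class_def free_const_def) (simp add: free_ring_def)
  then show ?thesis by (simp add: q_class_eq_q_elem coeff_simps)
qed

lemma q_x_eq: "q_x q = q_elem q 0 1 0 0"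
  by (simp add: q_x_def q_class_eq_q_elem coeff_simps)

lemma q_y_eq: "q_y q = q_elem q 0 0 1 0"
  by (simp add: q_y_def q_class_eq_q_elem coeff_simps)

lemmas q_basis_eq = q_one_eq q_x_eq q_y_eq

section \<open>The functional \<open>q_lambda\<close> and the automorphism \<open>q_alpha\<close> in
  coordinates\<close>

text \<open>Uniqueness of coordinates lets a function on \<open>A\<close> be prescribed by a formula
  in them. This supplies the candidates for the definite descriptions of \<open>q_lambda\<close> and
  \<open>q_alpha\<close>.\<close>

lemma q_elem_function_exists:
  obtains f where "f \<in> extensional (carrier (q_algebra q))"
    and "\<And>k l m n. f (q_elem q k l m n) = g k l m n"
proof
  let ?f = "\<lambda>z\<in>carrier (q_algebra q). THE w. \<exists>k l m n. z = q_elem q k l m n \<and> w = g k l m n"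
  show "?f \<in> extensional (carrier (q_algebra q))" by simp
  show "?f (q_elem q k l m n) = g k l m n" for k l m n by simp
qed

text \<open>The last coordinate satisfies the description, and a linear functional is determined by
  its values on the basis.\<close>

lemma q_lambda_elem: "q_lambda q (q_elem q k l m n) = n"
proof -
  let ?P = "\<lambda>f. f \<in> extensional (carrier (q_algebra q)) \<and> linear_functional (q_algebra q) f \<and>
    f \<one>\<^bsub>q_algebra q\<^esub> = 0 \<and> f (q_x q) = 0 \<and> f (q_y q) = 0 \<and>
    f (q_x q \<otimes>\<^bsub>q_algebra q\<^esub> q_y q) = 1"
  obtain f where f: "f \<in> extensional (carrier (q_algebra q))"
    "\<And>k l m n. f (q_elem q k l m n) = n"
    using q_elem_function_exists[of q "\<lambda>k l m n. n"] by blast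
  have "?P f"
    using f by (auto simp: linear_functional_def q_basis_eq carrier_q_algebra)
  moreover have "h = f" if h: "?P h" for h
  \<comment> \<open>Both functions are \<open>undefined\<close> off the carrier, so agreement on it
    is enough.\<close>
  proof (rule extensionalityI[of _ "carrier (q_algebra q)"])
    fix z assume "z \<in> carrier (q_algebra q)"
    then obtain k l m n where z: "z = q_elem q k l m n" by (auto simp: carrier_q_algebra)
    have add: "h (u \<oplus>\<^bsub>q_algebra q\<^esub> v) = h u + h v"
      if "u \<in> carrier (q_algebra q)" "v \<in> carrier (q_algebra q)" for u v
      using h that by (simp add: linear_functional_def)
    have smult: "h (c \<odot>\<^bsub>q_algebra q\<^esub> v) = c * h v" if "v \<in> carrier (q_algebra q)" for c v
      using h that by (simp add: linear_functional_def)
    have basis: "h (q_elem q 1 0 0 0) = 0" "h (q_elem q 0 1 0 0) = 0" "h (q_elem q 0 0 1 0) = 0"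
      "h (q_elem q 0 0 0 1) = 1"
      using h by (simp_all add: q_basis_eq)
    \<comment> \<open>The instances split \<open>z\<close> into two halves, each half into two
      summands, and each summand into a scalar times a basis element.\<close>
    have "h z = n"
      using add[of "q_elem q k l 0 0" "q_elem q 0 0 m n"]
        add[of "q_elem q k 0 0 0" "q_elem q 0 l 0 0"] add[of "q_elem q 0 0 m 0" "q_elem q 0 0 0 n"]
        smult[of "q_elem q 1 0 0 0" k] smult[of "q_elem q 0 1 0 0" l]
        smult[of "q_elem q 0 0 1 0" m] smult[of "q_elem q 0 0 0 1" n]
      by (simp add: z basis)
    then show "h z = f z" by (simp add: z f)
  qed (use h f in auto)
  ultimately have "q_lambda q = f" unfolding q_lambda_def by (rule the_equality)
  then show ?thesis by (simp add: f)
qed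

text \<open>The images of x and y force \<open>xy\<close> to go to
  \<open>(ax + cxy)(by + dxy) = ab xy\<close>, since products of degree three vanish. As
  \<open>a\<close> and \<open>b\<close> are non-zero, the resulting linear map is bijective.\<close>

lemma q_alpha_elem:
  assumes "a \<noteq> 0" "b \<noteq> 0"
  shows "q_alpha q a b c d (q_elem q k l m n) =
    q_elem q k (a * l) (b * m) (c * l + d * m + a * b * n)"
proof -
  let ?P = "\<lambda>u. u \<in> extensional (carrier (q_algebra q)) \<and> algebra_automorphism (q_algebra q) u \<and>
    u (q_x q) = a \<odot>\<^bsub>q_algebra q\<^esub> q_x q \<oplus>\<^bsub>q_algebra q\<^esub>
      c \<odot>\<^bsub>q_algebra q\<^esub> (q_x q \<otimes>\<^bsub>q_algebra q\<^esub> q_y q) \<and>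
    u (q_y q) = b \<odot>\<^bsub>q_algebra q\<^esub> q_y q \<oplus>\<^bsub>q_algebra q\<^esub>
      d \<odot>\<^bsub>q_algebra q\<^esub> (q_x q \<otimes>\<^bsub>q_algebra q\<^esub> q_y q)"
  obtain f where f: "f \<in> extensional (carrier (q_algebra q))"
    "\<And>k l m n. f (q_elem q k l m n) = q_elem q k (a * l) (b * m) (c * l + d * m + a * b * n)"
    using q_elem_function_exists[of q "\<lambda>k l m n. q_elem q k (a * l) (b * m) (c * l + d * m + a * b * n)"]
    by blast
  have "f \<in> ring_hom (q_algebra q) (q_algebra q)"
    by (rule ring_hom_memI) (auto simp: carrier_q_algebra f q_one_eq algebra_simps)
  moreover have "bij_betw f (carrier (q_algebra q)) (carrier (q_algebra q))"
  proof (rule bij_betw_imageI)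
    show "inj_on f (carrier (q_algebra q))"
      using assms by (auto simp: inj_on_def carrier_q_algebra f)
    \<comment> \<open>The preimage solves a triangular system: the x and y coordinates first, then
      the xy coordinate after subtracting their contributions.\<close>
    have "q_elem q k l m n =
      f (q_elem q k (l / a) (m / b) ((n - c * (l / a) - d * (m / b)) / (a * b)))" for k l m n
      using assms by (simp add: f)
    then have "q_elem q k l m n \<in> f ` carrier (q_algebra q)" for k l m n
      by (rule image_eqI) (rule q_elem_carrier)
    then show "f ` carrier (q_algebra q) = carrier (q_algebra q)"
      by (auto simp: f carrier_q_algebra)
  qed
  ultimately have "?P f"
    using f by (auto simp: algebra_automorphism_def q_basis_eq carrier_q_algebra algebra_simps)
  moreover have "h = f" if h: "?P h" for h
  proof (rule extensionalityI[of _ "carrier (q_algebra q)"])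
    fix z assume "z \<in> carrier (q_algebra q)"
    then obtain k l m n where z: "z = q_elem q k l m n" by (auto simp: carrier_q_algebra)
    have hom: "h \<in> ring_hom (q_algebra q) (q_algebra q)"
      using h by (simp add: algebra_automorphism_def)
    have smult: "h (c \<odot>\<^bsub>q_algebra q\<^esub> v) = c \<odot>\<^bsub>q_algebra q\<^esub> h v"
      if "v \<in> carrier (q_algebra q)" for c v
      using h that by (simp add: algebra_automorphism_def)
    have basis: "h (q_elem q 1 0 0 0) = q_elem q 1 0 0 0" "h (q_elem q 0 1 0 0) = q_elem q 0 a 0 c"
      "h (q_elem q 0 0 1 0) = q_elem q 0 0 b d"
      using h ring_hom_one[OF hom] by (simp_all add: q_basis_eq)
    have xy: "h (q_elem q 0 0 0 1) = q_elem q 0 0 0 (a * b)"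
      using ring_hom_mult[OF hom, of "q_elem q 0 1 0 0" "q_elem q 0 0 1 0"] by (simp add: basis)
    note add = ring_hom_add[OF hom]
    show "h z = f z"
      using add[of "q_elem q k l 0 0" "q_elem q 0 0 m n"]
        add[of "q_elem q k 0 0 0" "q_elem q 0 l 0 0"] add[of "q_elem q 0 0 m 0" "q_elem q 0 0 0 n"]
        smult[of "q_elem q 1 0 0 0" k] smult[of "q_elem q 0 1 0 0" l]
        smult[of "q_elem q 0 0 1 0" m] smult[of "q_elem q 0 0 0 1" n]
      by (simp add: z f basis xy algebra_simps)
  qed (use h f in auto)
  ultimately have "q_alpha q a b c d = f" unfolding q_alpha_def by (rule the_equality)
  then show ?thesis by (simp add: f)
qed

section \<open>The Jacobian of \<open>q_alpha\<close>\<close>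

lemma q_frobenius_simps [simp]:
  "carrier (q_frobenius q) = carrier (q_algebra q)" "mult (q_frobenius q) = mult (q_algebra q)"
  "one (q_frobenius q) = one (q_algebra q)" "add (q_frobenius q) = add (q_algebra q)"
  "smult (q_frobenius q) = smult (q_algebra q)"
  "form (q_frobenius q) u v = q_lambda q (u \<otimes>\<^bsub>q_algebra q\<^esub> v)"
  by (simp_all add: q_frobenius_def frobenius_of_def module.defs frobenius.defs)

theorem lemma31:
  fixes q a b c d :: "'k::field"
  assumes "q \<noteq> 0" and "a \<noteq> 0" and "b \<noteq> 0"
  shows "nakayama_jacobian (q_frobenius q) (q_alpha q a b c d) =
    (a * b) \<odot>\<^bsub>q_frobenius q\<^esub> \<one>\<^bsub>q_frobenius q\<^esub>
    \<oplus>\<^bsub>q_frobenius q\<^esub> d \<odot>\<^bsub>q_frobenius q\<^esub> q_x q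
    \<oplus>\<^bsub>q_frobenius q\<^esub> (inverse q * c) \<odot>\<^bsub>q_frobenius q\<^esub> q_y q"
proof -
  \<comment> \<open>This is the description in \<open>nakayama_jacobian\<close> after
    \<open>q_frobenius_simps\<close> has rewritten the form and the operations.\<close>
  let ?J = "\<lambda>j. j \<in> carrier (q_algebra q) \<and>
    (\<forall>r\<in>carrier (q_algebra q). \<forall>s\<in>carrier (q_algebra q).
      q_lambda q (q_alpha q a b c d r \<otimes>\<^bsub>q_algebra q\<^esub> q_alpha q a b c d s) =
      q_lambda q ((j \<otimes>\<^bsub>q_algebra q\<^esub> r) \<otimes>\<^bsub>q_algebra q\<^esub> s))"
  have "?J (q_elem q (a * b) d (inverse q * c) 0)"
  proof (intro conjI ballI q_elem_carrier)
    fix r s assume "r \<in> carrier (q_algebra q)" "s \<in> carrier (q_algebra q)"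
    then show "q_lambda q (q_alpha q a b c d r \<otimes>\<^bsub>q_algebra q\<^esub> q_alpha q a b c d s) =
      q_lambda q ((q_elem q (a * b) d (inverse q * c) 0 \<otimes>\<^bsub>q_algebra q\<^esub> r) \<otimes>\<^bsub>q_algebra q\<^esub> s)"
      \<comment> \<open>The \<open>inverse q\<close> in the y coordinate of the witness cancels the
        \<open>q\<close> produced by moving y past x.\<close>
      using assms by (auto simp: carrier_q_algebra q_alpha_elem q_lambda_elem field_simps)
  qed
  moreover have "j = q_elem q (a * b) d (inverse q * c) 0" if j: "?J j" for j
  proof -
    obtain k l m n where j_eq: "j = q_elem q k l m n"
      using j by (auto simp: carrier_q_algebra)
    have "q_lambda q (q_alpha q a b c d r \<otimes>\<^bsub>q_algebra q\<^esub> q_alpha q a b c d (q_elem q 1 0 0 0)) =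
      q_lambda q ((j \<otimes>\<^bsub>q_algebra q\<^esub> r) \<otimes>\<^bsub>q_algebra q\<^esub> q_elem q 1 0 0 0)"
      if "r \<in> carrier (q_algebra q)" for r
      using j that by simp
    \<comment> \<open>Testing on 1, x, y, xy isolates the coordinates of \<open>j\<close> at xy, y,
      x, 1 respectively, because the form pairs complementary basis elements. The pairing of y with
      x contributes \<open>q\<close>, hence \<open>q * m = c\<close>.\<close>
    from this[of "q_elem q 1 0 0 0"] this[of "q_elem q 0 1 0 0"] this[of "q_elem q 0 0 1 0"]
      this[of "q_elem q 0 0 0 1"]
    have "n = 0" "q * m = c" "l = d" "k = a * b"
      using assms by (simp_all add: j_eq q_alpha_elem q_lambda_elem)
    moreover from \<open>q * m = c\<close> have "m = inverse q * c" using assms(1) by auto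
    ultimately show ?thesis by (simp add: j_eq)
  qed
  ultimately have "nakayama_jacobian (q_frobenius q) (q_alpha q a b c d) =
      q_elem q (a * b) d (inverse q * c) 0"
    unfolding nakayama_jacobian_def q_frobenius_simps by (rule the_equality)
  then show ?thesis by (simp add: q_basis_eq)
qed

end
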